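(* Let $\mathcal{C}_0$ be the set of all not identically zero polynomials in $n$ of the form $$\alpha(n,0)=n\bigl((n-1)b_2+s_2\bigr)\bigl((n^2-3n+2)b_2+(n-1)(b_1+s_2)+b_0+s_1\bigr),$$ where $b_0,b_1,b_2,s_1,s_2\in\mathbb{C}$. Then $\mathcal{C}_0$ is the set of all nonzero polynomials in $n$ with complex coefficients whose degree is $4$, $2$, or $1$ and which have a root at $n=0$. *)

theory Defs
  imports Complex_Main "HOL-Computational_Algebra.Polynomial"
begin

text \<open>The indeterminate \<open>n\<close> is the polynomial \<open>[:0, 1:]\<close>, and a scalar \<open>c\<close> is the
  constant polynomial \<open>[:c:]\<close>.\<close>

definition alpha0 :: "complex \<Rightarrow> complex \<Rightarrow> complex \<Rightarrow> complex \<Rightarrow> complex \<Rightarrow> complex poly" where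
  "alpha0 b0 b1 b2 s1 s2 =
    (let n = [:0, 1:] in
      n * ((n - 1) * [:b2:] + [:s2:])
        * ((n ^ 2 - 3 * n + 2) * [:b2:] + (n - 1) * ([:b1:] + [:s2:]) + [:b0:] + [:s1:]))"

definition C0 :: "complex poly set" where
  "C0 = {p. p \<noteq> 0 \<and> (\<exists>b0 b1 b2 s1 s2. p = alpha0 b0 b1 b2 s1 s2)}"

end

theory Submission
  imports Defs "HOL-Computational_Algebra.Fundamental_Theorem_Algebra"
begin

text \<open>The polynomial \<open>\<alpha>(n,0)\<close> is \<open>n\<close> times a factor of formal degree 1 times a factor of formal degree 2,
  both with leading coefficient \<open>b2\<close>: the degree is 4 if \<open>b2 \<noteq> 0\<close>, and otherwise the factors have degrees
  0 and at most 1. Conversely, over the complex numbers a cubic has a root and its leading coefficient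
  is a square \<open>b2\<^sup>2\<close>, so it splits into such a pair of factors; \<open>s2\<close>, \<open>b1\<close>, \<open>b0\<close> are then found by
  solving a triangular linear system with \<open>s1 = 0\<close>.\<close>

text \<open>The root at 0, the possible degrees and the equations for the parameters are all read
  off from this form.\<close>

lemma alpha0_factors:
  "alpha0 b0 b1 b2 s1 s2 =
    [:0, 1:] * ([:s2 - b2, b2:] * [:2 * b2 - (b1 + s2) + b0 + s1, b1 + s2 - 3 * b2, b2:])"
proof -
  have numerals: "(1 :: complex poly) = [:1:]" "(2 :: complex poly) = [:2:]" "(3 :: complex poly) = [:3:]"
    by (simp_all add: one_pCons numeral_poly)
  show ?thesis
    unfolding alpha0_def Let_def mult.assoc numerals
    by (simp add: power2_eq_square algebra_simps)
qed

lemma exists_alpha0_of_factors: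
  "\<exists>b0 b1 b2 s1 s2. [:0, 1:] * ([:d, c:] * [:v, u, c:]) = alpha0 b0 b1 b2 s1 s2"
proof (intro exI)
  \<comment> \<open>Comparing with \<open>alpha0_factors\<close>: \<open>b2 = c\<close>, then
    \<open>s2 - b2 = d\<close> gives \<open>s2\<close>, the coefficient \<open>u\<close> gives
    \<open>b1\<close>, and \<open>v\<close> gives \<open>b0\<close>. The value \<open>c = 0\<close>
    is allowed.\<close>
  show "[:0, 1:] * ([:d, c:] * [:v, u, c:]) = alpha0 (u + v + c) (u + 2 * c - d) c 0 (d + c)"
    unfolding alpha0_factors by (simp add: algebra_simps)
qed

lemma degree_alpha0:
  assumes "alpha0 b0 b1 b2 s1 s2 \<noteq> 0"
  shows "degree (alpha0 b0 b1 b2 s1 s2) \<in> {4, 2, 1}"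
proof (cases "b2 = 0")
  case True
  then show ?thesis
    using assms unfolding alpha0_factors by (auto simp: degree_mult_eq)
next
  case False
  then show ?thesis
    unfolding alpha0_factors by (simp add: degree_mult_eq)
qed

lemma degree_le_1_eq:
  fixes q :: "'a::zero poly"
  assumes "degree q \<le> 1"
  shows "q = [:coeff q 0, coeff q 1:]"
  using assms by (intro poly_eqI) (auto simp: coeff_pCons coeff_eq_0 split: nat.splits)

lemma degree_le_2_eq:
  fixes q :: "'a::zero poly"
  assumes "degree q \<le> 2"
  shows "q = [:coeff q 0, coeff q 1, coeff q 2:]"
  using assms
  by (intro poly_eqI) (auto simp: coeff_pCons coeff_eq_0 numeral_2_eq_2 split: nat.splits)

lemma cubic_factors_same_lead:
  fixes q :: "complex poly"
  assumes "degree q = 3"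
  obtains c d u v where "q = [:d, c:] * [:v, u, c:]"
proof -
  obtain z where "poly q z = 0"
    using assms fundamental_theorem_of_algebra_alt[of q] by (metis degree_pCons_0 zero_neq_numeral)
  then obtain r where r: "q = [:- z, 1:] * r"
    unfolding poly_eq_0_iff_dvd by (elim dvdE)
  with assms have "r \<noteq> 0" by auto
  with assms r have "degree r = 2"
    by (simp add: degree_mult_eq del: mult_pCons_left)
  \<comment> \<open>Dividing \<open>r\<close> by \<open>c\<close> and multiplying the linear factor
    by \<open>c\<close> keeps the product and gives both factors the leading coefficient
    \<open>c\<close>.\<close>
  define c where "c = csqrt (coeff r 2)"
  have c2: "c * c = coeff r 2"
    unfolding c_def by (metis power2_csqrt power2_eq_square)
  with \<open>degree r = 2\<close> \<open>r \<noteq> 0\<close> have "c \<noteq> 0"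
    by (metis leading_coeff_0_iff mult_zero_left)
  have "q = [:- z, 1:] * [:coeff r 0, coeff r 1, coeff r 2:]"
    using r degree_le_2_eq[of r] \<open>degree r = 2\<close> by simp
  also have "\<dots> = [:- (c * z), c:] * [:coeff r 0 / c, coeff r 1 / c, c:]"
    using \<open>c \<noteq> 0\<close> by (simp add: c2[symmetric])
  finally show ?thesis by (rule that)
qed

theorem mainTheorem4:
  "C0 = {p :: complex poly. p \<noteq> 0 \<and> degree p \<in> {4, 2, 1} \<and> poly p 0 = 0}"
proof (intro subset_antisym subsetI)
  fix p assume "p \<in> C0"
  then obtain b0 b1 b2 s1 s2 where "p \<noteq> 0" and p: "p = alpha0 b0 b1 b2 s1 s2"
    unfolding C0_def by blast
  have "poly p 0 = 0"
    unfolding p alpha0_factors by simp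
  with \<open>p \<noteq> 0\<close> degree_alpha0 show "p \<in> {p. p \<noteq> 0 \<and> degree p \<in> {4, 2, 1} \<and> poly p 0 = 0}"
    unfolding p by blast
next
  fix p :: "complex poly"
  assume "p \<in> {p. p \<noteq> 0 \<and> degree p \<in> {4, 2, 1} \<and> poly p 0 = 0}"
  then have "p \<noteq> 0" and deg: "degree p \<in> {4, 2, 1}" and "poly p 0 = 0"
    by auto
  then obtain q where q: "p = [:0, 1:] * q"
    using poly_eq_0_iff_dvd[of p 0] by (auto elim: dvdE)
  with \<open>p \<noteq> 0\<close> have "q \<noteq> 0" by auto
  then have "degree p = Suc (degree q)"
    unfolding q by (simp add: degree_mult_eq)
  \<comment> \<open>Degree 4 of \<open>p\<close> gives the first case, degrees 2 and 1 the
    second.\<close>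
  with deg consider "degree q = 3" | "degree q \<le> 1"
    by auto
  then have "\<exists>b0 b1 b2 s1 s2. p = alpha0 b0 b1 b2 s1 s2"
  proof cases
    case 1
    then obtain c d u v where "q = [:d, c:] * [:v, u, c:]"
      by (rule cubic_factors_same_lead)
    then show ?thesis
      using exists_alpha0_of_factors unfolding q by simp
  next
    case 2
    \<comment> \<open>This is the required shape with \<open>c = 0\<close>: the linear factor
      degenerates to the constant 1.\<close>
    have "q = [:1, 0:] * [:coeff q 0, coeff q 1, 0:]"
      using degree_le_1_eq[OF 2] by simp
    then show ?thesis
      using exists_alpha0_of_factors unfolding q by metis
  qed
  with \<open>p \<noteq> 0\<close> show "p \<in> C0"
    unfolding C0_def by blast
qed

end
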